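(* A nonzero tensor $A\in\mathrm{Sym}^d(\mathbb{R}^n)$ is critical in $\mathrm{Sym}^d(\mathbb{R}^n)$ if and only if there exist $r\in\mathbb{N}$, symmetric best rank-one approximations $Y_1,\dots,Y_r$ of $A$, and coefficients $\alpha_1,\dots,\alpha_r>0$ with $\sum_\ell\alpha_\ell=1$, such that \[ \Big(\frac{\|A\|_2}{\|A\|_F}\Big)^2A=\sum_{\ell=1}^r\alpha_\ell Y_\ell. \] In this case $A$ is also critical in the full space $\otimes_{j=1}^d\mathbb{R}^n$.
   Context: Tensors and norms: \begin{itemize} \item $\mathrm{Sym}^d(\mathbb{R}^n)$ is the space of real $n^d$-tensors invariant under permutation of indices. \item The Frobenius inner product is $\langle A,A'\rangle_F=\sum a_{i_1\dots i_d}a'_{i_1\dots i_d}$, with norm $\|\cdot\|_F$. \item The spectral norm is $\|A\|_2=\max_{\|x^{(j)}\|=1}\langle A,x^{(1)}\otimes\cdots\otimes x^{(d)}\rangle_F$. \end{itemize} A best rank-one approximation of $A$ is a rank-one tensor $Y$ minimizing $\|A-X\|_F$ over all rank-one tensors $X$. It is symmetric if it has the form $\lambda\,y\otimes\cdots\otimes y$. Generalized gradient (Clarke): for a Lipschitz function $f$ on a Euclidean space, the generalized gradient $\partial f(p)$ is the convex hull of all limits of gradients $\nabla f(p_i)$, taken over sequences $p_i\to p$ of differentiability points. Criticality: \begin{itemize} \item A nonzero $A\in\mathrm{Sym}^d(\mathbb{R}^n)$ is critical in $\mathrm{Sym}^d(\mathbb{R}^n)$ if $\lambda A\in\partial g(A/\|A\|_F)$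 for some $\lambda\in\mathbb{R}$, where $g$ is the spectral norm regarded as a function on the Euclidean space $(\mathrm{Sym}^d(\mathbb{R}^n),\langle\cdot,\cdot\rangle_F)$. \item $A$ is critical in $\otimes_{j=1}^d\mathbb{R}^n$ if the same holds with the spectral norm regarded as a function on the full tensor space. \end{itemize} *)

theory Defs
  imports "HOL-Analysis.Analysis"
begin

text \<open>Tensors of order d = CARD('d) on R^n with n = CARD('n) are vectors indexed by
  multi-indices i :: 'd \<Rightarrow> 'n. The Euclidean inner product on real ^ ('d \<Rightarrow> 'n)
  is exactly the Frobenius inner product.\<close>

type_synonym ('d, 'n) tensor = "real ^ ('d \<Rightarrow> 'n)"

definition sym_tensors :: "('d::finite, 'n::finite) tensor set" where
  "sym_tensors = {A. \<forall>\<sigma>::'d \<Rightarrow> 'd. bij \<sigma> \<longrightarrow> (\<forall>i. A $ (i \<circ> \<sigma>) = A $ i)}"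

definition outer :: "('d::finite \<Rightarrow> real ^ 'n::finite) \<Rightarrow> ('d, 'n) tensor" where
  "outer x = (\<chi> i. \<Prod>j\<in>UNIV. x j $ i j)"

definition spectral_norm :: "('d::finite, 'n::finite) tensor \<Rightarrow> real" where
  "spectral_norm A = Sup {A \<bullet> outer x | x. \<forall>j. norm (x j) = 1}"

definition rank_one :: "('d::finite, 'n::finite) tensor \<Rightarrow> bool" where
  "rank_one X \<longleftrightarrow> X \<noteq> 0 \<and> (\<exists>x. X = outer x)"

definition best_rank_one_approx :: "('d::finite, 'n::finite) tensor \<Rightarrow> ('d, 'n) tensor \<Rightarrow> bool" where
  "best_rank_one_approx A Y \<longleftrightarrow> rank_one Y \<and> (\<forall>X. rank_one X \<longrightarrow> norm (A - Y) \<le> norm (A - X))"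

definition sym_rank_one_form :: "('d::finite, 'n::finite) tensor \<Rightarrow> bool" where
  "sym_rank_one_form Y \<longleftrightarrow> (\<exists>(c::real) (y::real ^ 'n). Y = c *\<^sub>R outer (\<lambda>_. y))"

text \<open>Clarke generalized gradient of f regarded as a function on the Euclidean space S
  (a linear subspace of the ambient space, with the induced inner product): convex hull of
  all limits of gradients (elements of S) at differentiability points in S converging to p.\<close>
definition clarke_grad :: "'a::euclidean_space set \<Rightarrow> ('a \<Rightarrow> real) \<Rightarrow> 'a \<Rightarrow> 'a set" where
  "clarke_grad S f p = convex hull
     {v. \<exists>ps vs. (\<forall>k. ps k \<in> S \<and> vs k \<in> S \<and>
                     (f has_derivative (\<lambda>h. vs k \<bullet> h)) (at (ps k) within S))
               \<and> ps \<longlonglongrightarrow> p \<and> vs \<longlonglongrightarrow> v}"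

definition critical_in_sym :: "('d::finite, 'n::finite) tensor \<Rightarrow> bool" where
  "critical_in_sym A \<longleftrightarrow> A \<in> sym_tensors \<and> A \<noteq> 0 \<and>
     (\<exists>c::real. c *\<^sub>R A \<in> clarke_grad sym_tensors spectral_norm (A /\<^sub>R norm A))"

definition critical_in_full :: "('d::finite, 'n::finite) tensor \<Rightarrow> bool" where
  "critical_in_full A \<longleftrightarrow> A \<noteq> 0 \<and>
     (\<exists>c::real. c *\<^sub>R A \<in> clarke_grad UNIV spectral_norm (A /\<^sub>R norm A))"

end

theory Submission
  imports Defs
begin

text \<open>The spectral norm is the maximum of the linear functionals X \<mapsto> \<langle>A, X\<rangle> over unit rank-one
  tensors X, and the best rank-one approximations of A are exactly the tensors |A|_2 X for such
  maximizers X. Every maximizer X of p is a gradient of the spectral norm, at p + t X for t > 0,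
  so it lies in the generalized gradient at p, in any subspace containing p and X. Conversely,
  at a point where the restriction to symmetric tensors is differentiable, the gradient coincides
  with every symmetric maximizer, and one exists by Banach's theorem; taking limits, the
  generalized gradient in Sym at p lies in the convex hull of the symmetric unit maximizers of p.
  Pairing a multiple c A in that hull with A pins down c, which yields the factor
  (|A|_2 / |A|_F)^2.\<close>

abbreviation unit_factors :: "('d \<Rightarrow> 'a::real_normed_vector) \<Rightarrow> bool" where
  "unit_factors x \<equiv> \<forall>j. norm (x j) = 1"

section \<open>Outer products\<close>

lemma inner_outer: "outer x \<bullet> outer z = (\<Prod>j\<in>UNIV. x j \<bullet> z j)"
proof -
  have "outer x \<bullet> outer z = (\<Sum>i\<in>UNIV. \<Prod>j\<in>UNIV. x j $ i j * z j $ i j)"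
    by (simp add: outer_def inner_vec_def prod.distrib)
  also have "\<dots> = (\<Prod>j\<in>UNIV. \<Sum>k\<in>UNIV. x j $ k * z j $ k)"
    using prod_sum_PiE[of UNIV "\<lambda>_. UNIV" "\<lambda>j k. x j $ k * z j $ k"] by simp
  finally show ?thesis
    by (simp add: inner_vec_def)
qed

lemma norm_outer: "norm (outer x) = (\<Prod>j\<in>UNIV. norm (x j))"
proof -
  have "norm (outer x) ^ 2 = (\<Prod>j\<in>UNIV. norm (x j)) ^ 2"
    by (simp add: power2_norm_eq_inner inner_outer prod_power_distrib)
  then show ?thesis
    by (metis norm_ge_zero power2_eq_iff_nonneg prod_nonneg)
qed

lemma norm_outer_unit: "unit_factors x \<Longrightarrow> norm (outer x) = 1"
  by (simp add: norm_outer)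

lemma outer_scale: "outer (\<lambda>j. c j *\<^sub>R x j) = (\<Prod>j\<in>UNIV. c j) *\<^sub>R outer x"
  by (simp add: outer_def vec_eq_iff prod.distrib)

lemma outer_upd: "outer (x(i := w)) = (\<chi> idx. w $ idx i * (\<Prod>k\<in>UNIV - {i}. x k $ idx k))"
proof -
  have "(\<Prod>k\<in>UNIV. (x(i := w)) k $ idx k) = w $ idx i * (\<Prod>k\<in>UNIV - {i}. x k $ idx k)" for idx
    by (subst prod.remove[of UNIV i]) (auto intro!: prod.cong)
  then show ?thesis
    by (simp add: outer_def)
qed

lemma outer_upd_add: "outer (x(i := u + v)) = outer (x(i := u)) + outer (x(i := v))"
  by (simp add: outer_upd vec_eq_iff algebra_simps)

lemma outer_upd_scale: "outer (x(i := c *\<^sub>R u)) = c *\<^sub>R outer (x(i := u))"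
  by (simp add: outer_upd vec_eq_iff algebra_simps)

lemma outer_upd_scale_self: "outer (x(i := c *\<^sub>R x i)) = c *\<^sub>R outer x"
  using outer_upd_scale[of x i c "x i"] by simp

lemma outer_eq_0: "x i = 0 \<Longrightarrow> outer x = 0"
  using outer_upd_scale_self[of x i 0] by (simp add: fun_upd_idem)

lemma linear_inner_outer_upd: "linear (\<lambda>u. A \<bullet> outer (x(i := u)))"
  by (rule linearI) (simp_all add: outer_upd_add outer_upd_scale inner_add_right)

lemma outer_axis: "outer (\<lambda>j. axis (idx j) (1::real)) = axis idx 1"
proof -
  have "(\<Prod>j\<in>UNIV. axis (idx j) (1::real) $ i j) = (if i = idx then 1 else 0)" for i
  proof (cases "i = idx")
    case False
    then obtain j where "i j \<noteq> idx j"
      by auto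
    then show ?thesis
      using False by (intro trans[OF prod_zero]) (auto simp: axis_def intro!: bexI[of _ j])
  qed (simp add: axis_def)
  then show ?thesis
    by (simp add: outer_def vec_eq_iff axis_def)
qed

lemma outer_normalize:
  assumes "\<And>j. z j \<noteq> 0"
  shows "outer z = (\<Prod>j\<in>UNIV. norm (z j)) *\<^sub>R outer (\<lambda>j. sgn (z j))"
    and "unit_factors (\<lambda>j. sgn (z j))"
proof -
  have "z = (\<lambda>j. norm (z j) *\<^sub>R sgn (z j))"
    using assms by (simp add: fun_eq_iff sgn_div_norm)
  then show "outer z = (\<Prod>j\<in>UNIV. norm (z j)) *\<^sub>R outer (\<lambda>j. sgn (z j))"
    by (metis outer_scale)
  show "unit_factors (\<lambda>j. sgn (z j))"
    using assms by (simp add: norm_sgn)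
qed

lemma subspace_sym_tensors: "subspace sym_tensors"
  unfolding subspace_def sym_tensors_def by auto

lemma bij_comp_right: "bij \<sigma> \<Longrightarrow> bij (\<lambda>f. f \<circ> \<sigma>)"
  by (rule o_bij[of "\<lambda>f. f \<circ> inv \<sigma>"])
    (auto simp: fun_eq_iff bij_is_surj bij_is_inj surj_f_inv_f inv_f_f)

lemma outer_comp_index: "bij \<sigma> \<Longrightarrow> outer (x \<circ> \<sigma>) $ (idx \<circ> \<sigma>) = outer x $ idx"
  using prod.reindex_bij_betw[of \<sigma> UNIV UNIV "\<lambda>k. x k $ idx k"]
  by (simp add: outer_def bij_betw_def bij_def)

lemma outer_const_mem_sym_tensors: "outer (\<lambda>_. y) \<in> sym_tensors"
proof -
  have "outer (\<lambda>_. y) $ (i \<circ> \<sigma>) = outer (\<lambda>_. y) $ i" if "bij \<sigma>" for \<sigma> i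
    using outer_comp_index[OF that, of "\<lambda>_. y" i] by (simp only: comp_def)
  then show ?thesis
    unfolding sym_tensors_def by blast
qed

lemma sym_tensor_inner_outer_comp:
  assumes A: "A \<in> sym_tensors" and \<sigma>: "bij \<sigma>"
  shows "A \<bullet> outer (x \<circ> \<sigma>) = A \<bullet> outer x"
proof -
  have "A \<bullet> outer (x \<circ> \<sigma>) = (\<Sum>idx\<in>UNIV. A $ idx * outer (x \<circ> \<sigma>) $ idx)"
    by (simp add: inner_vec_def)
  also have "\<dots> = (\<Sum>idx\<in>UNIV. A $ (idx \<circ> \<sigma>) * outer (x \<circ> \<sigma>) $ (idx \<circ> \<sigma>))"
    by (rule sum.reindex_bij_betw[OF bij_comp_right[OF \<sigma>], symmetric])
  also have "\<dots> = A \<bullet> outer x"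
    using A \<sigma> by (simp add: inner_vec_def outer_comp_index sym_tensors_def)
  finally show ?thesis .
qed

section \<open>The spectral norm\<close>

lemma exists_unit_factors: "\<exists>x::'d \<Rightarrow> real^'n::finite. unit_factors x"
  by (rule exI[of _ "\<lambda>_. axis undefined 1"]) (simp add: norm_axis_1)

lemma inner_outer_le_norm: "unit_factors x \<Longrightarrow> A \<bullet> outer x \<le> norm A"
  using norm_cauchy_schwarz[of A "outer x"] by (simp add: norm_outer_unit)

lemma bdd_above_inner_outer: "bdd_above {A \<bullet> outer x | x. unit_factors x}"
  by (rule bdd_aboveI[of _ "norm A"]) (auto intro: inner_outer_le_norm)

lemma inner_outer_le_spectral_norm: "unit_factors x \<Longrightarrow> A \<bullet> outer x \<le> spectral_norm A"
  unfolding spectral_norm_def by (rule cSup_upper[OF _ bdd_above_inner_outer]) auto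

lemma spectral_norm_le:
  fixes A :: "('d::finite, 'n::finite) tensor"
  assumes "\<And>x. unit_factors x \<Longrightarrow> A \<bullet> outer x \<le> M"
  shows "spectral_norm A \<le> M"
proof -
  obtain x0 :: "'d \<Rightarrow> real^'n" where "unit_factors x0"
    using exists_unit_factors by blast
  then have "{A \<bullet> outer x | x. unit_factors x} \<noteq> {}"
    by blast
  then show ?thesis
    unfolding spectral_norm_def using assms by (intro cSup_least) auto
qed

lemma abs_inner_outer_le_spectral_norm:
  assumes "unit_factors x"
  shows "\<bar>A \<bullet> outer x\<bar> \<le> spectral_norm A"
proof -
  let ?x = "x(undefined := - x undefined)"
  have "A \<bullet> outer ?x \<le> spectral_norm A"
    using assms by (intro inner_outer_le_spectral_norm) simp
  then show ?thesis
    using outer_upd_scale_self[of x undefined "-1"] inner_outer_le_spectral_norm[OF assms, of A]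
    by simp
qed

lemma spectral_norm_diff_le:
  fixes a b :: "('d::finite, 'n::finite) tensor"
  shows "spectral_norm a \<le> spectral_norm b + norm (a - b)"
proof (rule spectral_norm_le)
  fix x :: "'d \<Rightarrow> real^'n" assume x: "unit_factors x"
  have "a \<bullet> outer x = b \<bullet> outer x + (a - b) \<bullet> outer x"
    by (simp add: inner_diff_left)
  then show "a \<bullet> outer x \<le> spectral_norm b + norm (a - b)"
    using inner_outer_le_spectral_norm[OF x, of b] inner_outer_le_norm[OF x, of "a - b"] by simp
qed

lemma abs_spectral_norm_diff_le:
  fixes a b :: "('d::finite, 'n::finite) tensor"
  shows "\<bar>spectral_norm a - spectral_norm b\<bar> \<le> norm (a - b)"
  using spectral_norm_diff_le[of a b] spectral_norm_diff_le[of b a] by (simp add: norm_minus_commute)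

lemma tendsto_spectral_norm:
  fixes q :: "nat \<Rightarrow> ('d::finite, 'n::finite) tensor"
  assumes "q \<longlonglongrightarrow> p"
  shows "(\<lambda>k. spectral_norm (q k)) \<longlonglongrightarrow> spectral_norm p"
proof -
  have "(\<lambda>k. norm (q k - p)) \<longlonglongrightarrow> 0"
    using assms by (intro tendsto_norm_zero LIM_zero)
  then have "(\<lambda>k. spectral_norm (q k) - spectral_norm p) \<longlonglongrightarrow> 0"
    by (rule Lim_null_comparison[rotated]) (simp add: abs_spectral_norm_diff_le)
  then show ?thesis
    by (simp add: LIM_zero_iff)
qed

text \<open>Families of factors are packed into vectors of vectors, where compactness is available.\<close>

definition unit_factor_tuples :: "((real^'n::finite)^'d::finite) set" where
  "unit_factor_tuples = {X. \<forall>j. norm (X $ j) = 1}"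

lemma compact_unit_factor_tuples: "compact (unit_factor_tuples :: ((real^'n::finite)^'d::finite) set)"
proof -
  have "norm X \<le> real CARD('d)" if "X \<in> unit_factor_tuples" for X :: "(real^'n)^'d"
  proof -
    have "norm X = L2_set (\<lambda>i. norm (X $ i)) UNIV"
      by (simp add: norm_vec_def)
    also have "\<dots> \<le> (\<Sum>i\<in>UNIV. norm (X $ i))"
      by (rule L2_set_le_sum) auto
    also have "\<dots> = real CARD('d)"
      using that by (simp add: unit_factor_tuples_def)
    finally show ?thesis .
  qed
  then have "bounded (unit_factor_tuples :: ((real^'n)^'d) set)"
    unfolding bounded_iff by blast
  moreover have "unit_factor_tuples = (\<Inter>j. {X :: (real^'n)^'d. norm (X $ j) = 1})"
    by (auto simp: unit_factor_tuples_def)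
  moreover have "closed (\<Inter>j. {X :: (real^'n)^'d. norm (X $ j) = 1})"
    by (intro closed_INT ballI closed_Collect_eq continuous_intros)
  ultimately show ?thesis
    by (simp add: compact_eq_bounded_closed)
qed

lemma vec_lambda_mem_unit_factor_tuples: "vec_lambda x \<in> unit_factor_tuples \<longleftrightarrow> unit_factors x"
  by (simp add: unit_factor_tuples_def)

lemma continuous_on_outer_tuple: "continuous_on S (\<lambda>X::(real^'n::finite)^'d::finite. outer (($) X))"
  unfolding outer_def by (intro continuous_intros)

lemma spectral_norm_attained:
  "\<exists>x. unit_factors x \<and> A \<bullet> outer x = spectral_norm (A :: ('d::finite, 'n::finite) tensor)"
proof -
  obtain x0 :: "'d \<Rightarrow> real^'n" where "unit_factors x0"
    using exists_unit_factors by blast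
  then have ne: "(unit_factor_tuples :: ((real^'n)^'d) set) \<noteq> {}"
    using vec_lambda_mem_unit_factor_tuples by blast
  have "continuous_on unit_factor_tuples (\<lambda>X::(real^'n)^'d. A \<bullet> outer (($) X))"
    by (intro continuous_intros continuous_on_outer_tuple)
  then obtain X where X: "X \<in> unit_factor_tuples"
    and max: "\<And>Y. Y \<in> unit_factor_tuples \<Longrightarrow> A \<bullet> outer (($) Y) \<le> A \<bullet> outer (($) X)"
    using continuous_attains_sup[OF compact_unit_factor_tuples ne] by blast
  have "spectral_norm A \<le> A \<bullet> outer (($) X)"
  proof (rule spectral_norm_le)
    fix x :: "'d \<Rightarrow> real^'n"
    assume "unit_factors x"
    then show "A \<bullet> outer x \<le> A \<bullet> outer (($) X)"
      using max[of "vec_lambda x"] by (simp add: vec_lambda_mem_unit_factor_tuples vec_lambda_inverse)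
  qed
  moreover have "unit_factors (($) X)"
    using X by (simp add: unit_factor_tuples_def)
  ultimately show ?thesis
    by (meson antisym inner_outer_le_spectral_norm)
qed

lemma spectral_norm_pos:
  assumes "A \<noteq> 0"
  shows "0 < spectral_norm (A :: ('d::finite, 'n::finite) tensor)"
proof -
  obtain idx where idx: "A $ idx \<noteq> 0"
    using assms by (auto simp: vec_eq_iff)
  have "A \<bullet> outer (\<lambda>j. axis (idx j) 1) = A $ idx"
    by (simp add: outer_axis inner_axis)
  then show ?thesis
    using abs_inner_outer_le_spectral_norm[of "\<lambda>j. axis (idx j) 1" A] idx by (simp add: norm_axis_1)
qed

lemma spectral_norm_scaleR:
  assumes "0 \<le> c"
  shows "spectral_norm (c *\<^sub>R A) = c * spectral_norm (A :: ('d::finite, 'n::finite) tensor)"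
proof (rule antisym)
  show "spectral_norm (c *\<^sub>R A) \<le> c * spectral_norm A"
    using assms by (intro spectral_norm_le) (simp add: inner_outer_le_spectral_norm mult_left_mono)
  obtain x where "unit_factors x" "A \<bullet> outer x = spectral_norm A"
    using spectral_norm_attained by blast
  then show "c * spectral_norm A \<le> spectral_norm (c *\<^sub>R A)"
    using inner_outer_le_spectral_norm[of x "c *\<^sub>R A"] by simp
qed

lemma inner_outer_le_spectral_norm_mult_norm:
  "A \<bullet> outer z \<le> spectral_norm A * norm (outer z)"
proof (cases "\<forall>j. z j \<noteq> 0")
  case True
  let ?m = "\<Prod>j\<in>UNIV. norm (z j)"
  have nz: "\<And>j. z j \<noteq> 0"
    using True by blast
  have "A \<bullet> outer z = ?m * (A \<bullet> outer (\<lambda>j. sgn (z j)))"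
    using outer_normalize(1)[of z, OF nz] by simp
  also have "\<dots> \<le> ?m * spectral_norm A"
    using outer_normalize(2)[of z, OF nz]
    by (intro mult_left_mono inner_outer_le_spectral_norm) (auto simp: prod_nonneg)
  finally show ?thesis
    by (simp add: norm_outer mult.commute)
qed (auto simp: outer_eq_0)

section \<open>Best rank-one approximations\<close>

lemma norm_diff_power2: "norm (a - b)^2 = norm a ^ 2 - 2 * (a \<bullet> b) + norm b ^ 2"
  for a b :: "'a::real_inner"
  by (simp add: power2_norm_eq_inner inner_diff_left inner_diff_right inner_commute)

lemma norm_diff_scaled_maximizer:
  assumes "unit_factors x" and "A \<bullet> outer x = spectral_norm A"
  shows "norm (A - spectral_norm A *\<^sub>R outer x)^2 = norm A ^ 2 - spectral_norm A ^ 2"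
  unfolding norm_diff_power2 using assms by (simp add: norm_outer_unit power2_eq_square)

lemma best_rank_one_approx_maximizer:
  fixes A :: "('d::finite, 'n::finite) tensor"
  assumes A: "A \<noteq> 0" and x: "unit_factors x" and max: "A \<bullet> outer x = spectral_norm A"
  shows "best_rank_one_approx A (spectral_norm A *\<^sub>R outer x)"
  unfolding best_rank_one_approx_def
proof (intro conjI allI impI)
  have "spectral_norm A *\<^sub>R outer x = outer (x(undefined := spectral_norm A *\<^sub>R x undefined))"
    by (simp only: outer_upd_scale_self)
  moreover have "spectral_norm A *\<^sub>R outer x \<noteq> 0"
    using spectral_norm_pos[OF A] norm_outer_unit[OF x] by auto
  ultimately show "rank_one (spectral_norm A *\<^sub>R outer x)"
    unfolding rank_one_def by blast
  fix X :: "('d, 'n) tensor"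
  assume "rank_one X"
  then obtain z where X: "X = outer z"
    by (auto simp: rank_one_def)
  have "A \<bullet> X \<le> spectral_norm A * norm X"
    using inner_outer_le_spectral_norm_mult_norm X by simp
  moreover have "0 \<le> (norm X - spectral_norm A)^2"
    by simp
  ultimately have "norm A ^ 2 - spectral_norm A ^ 2 \<le> norm A ^ 2 - 2 * (A \<bullet> X) + norm X ^ 2"
    by (simp add: power2_diff algebra_simps)
  also have "\<dots> = norm (A - X)^2"
    by (simp add: norm_diff_power2)
  finally have "norm (A - spectral_norm A *\<^sub>R outer x)^2 \<le> norm (A - X)^2"
    using norm_diff_scaled_maximizer[OF x max] by simp
  then show "norm (A - spectral_norm A *\<^sub>R outer x) \<le> norm (A - X)"
    by (rule power2_le_imp_le) simp
qed

lemma best_rank_one_approx_imp_maximizer: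
  fixes A :: "('d::finite, 'n::finite) tensor"
  assumes A: "A \<noteq> 0" and Y: "best_rank_one_approx A Y"
  obtains x where "unit_factors x" "Y = spectral_norm A *\<^sub>R outer x"
    "A \<bullet> outer x = spectral_norm A"
proof -
  let ?sn = "spectral_norm A"
  obtain z where Yz: "Y = outer z" and Y0: "Y \<noteq> 0"
    and opt: "\<And>X. rank_one X \<Longrightarrow> norm (A - Y) \<le> norm (A - X)"
    using Y by (auto simp: best_rank_one_approx_def rank_one_def)
  have nz: "\<And>j. z j \<noteq> 0"
    using Y0 Yz outer_eq_0 by metis
  let ?u = "\<lambda>j. sgn (z j)"
  define m where "m = (\<Prod>j\<in>UNIV. norm (z j))"
  define a where "a = A \<bullet> outer ?u"
  have Ym: "Y = m *\<^sub>R outer ?u" and u: "unit_factors ?u"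
    using outer_normalize[of z, OF nz] Yz m_def by auto
  have m: "0 < m"
    unfolding m_def using nz by (simp add: prod_pos)
  have a: "a \<le> ?sn"
    unfolding a_def by (rule inner_outer_le_spectral_norm[OF u])
  obtain x where x: "unit_factors x" "A \<bullet> outer x = ?sn"
    using spectral_norm_attained by blast
  then have "norm (A - Y) \<le> norm (A - ?sn *\<^sub>R outer x)"
    using best_rank_one_approx_maximizer[OF A] opt by (simp add: best_rank_one_approx_def)
  then have "norm (A - Y)^2 \<le> norm (A - ?sn *\<^sub>R outer x)^2"
    by (simp add: power_mono)
  moreover have "norm (A - Y)^2 = norm A ^ 2 - 2 * m * a + m^2"
    unfolding Ym norm_diff_power2 by (simp add: a_def norm_outer_unit[OF u] power2_eq_square)
  ultimately have "(m - ?sn)^2 + 2 * (m * (?sn - a)) \<le> 0"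
    unfolding norm_diff_scaled_maximizer[OF x] by (simp add: power2_diff algebra_simps)
  moreover have "0 \<le> m * (?sn - a)"
    using m a by simp
  moreover have "0 \<le> (m - ?sn)^2"
    by simp
  ultimately have "(m - ?sn)^2 = 0" "m * (?sn - a) = 0"
    by linarith+
  then have "m = ?sn" "a = ?sn"
    using m by simp_all
  then show ?thesis
    using that[OF u] Ym a_def by simp
qed

section \<open>Symmetric maximizers\<close>

lemma linear_eq_of_attained_bound:
  fixes L :: "'a::euclidean_space \<Rightarrow> real"
  assumes lin: "linear L" and bnd: "\<And>u. norm u = 1 \<Longrightarrow> L u \<le> lam"
    and a: "norm a = 1" and La: "L a = lam"
  shows "L u = lam * (a \<bullet> u)"
proof -
  define c where "c = adjoint L 1"
  have c: "L u = c \<bullet> u" for u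
    using adjoint_works[OF lin, of u 1] by (simp add: c_def inner_commute)
  have "norm c \<le> lam"
  proof (cases "c = 0")
    case True
    then show ?thesis
      using La c by simp
  next
    case False
    then have "L (sgn c) = norm c"
      by (simp add: c sgn_div_norm dot_square_norm power2_eq_square)
    then show ?thesis
      using bnd[of "sgn c"] False by (simp add: norm_sgn)
  qed
  moreover have "norm (c - lam *\<^sub>R a)^2 = norm c ^ 2 - lam^2"
    unfolding norm_diff_power2 using a La c by (simp add: power2_eq_square)
  moreover have "norm c ^ 2 \<le> lam ^ 2"
    using \<open>norm c \<le> lam\<close> by (simp add: power_mono)
  ultimately have "norm (c - lam *\<^sub>R a)^2 \<le> 0"
    by simp
  then have "c = lam *\<^sub>R a"
    by simp
  then show ?thesis
    using c by simp
qed

text \<open>Banach's argument: a maximum of a symmetric bilinear form on pairs of unit vectors is also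
  attained on the diagonal (up to sign), at the normalized sum or difference of the two vectors.\<close>

lemma symmetric_bilinear_max_sgn:
  fixes B :: "'a::euclidean_space \<Rightarrow> 'a \<Rightarrow> real"
  assumes lin: "\<And>v. linear (\<lambda>u. B u v)" and sym: "\<And>u v. B u v = B v u"
    and bnd: "\<And>u v. norm u = 1 \<Longrightarrow> norm v = 1 \<Longrightarrow> B u v \<le> lam"
    and a: "norm a = 1" and b: "norm b = 1" and ab: "B a b = lam"
  shows "a + b \<noteq> 0 \<Longrightarrow> B (sgn (a + b)) (sgn (a + b)) = lam"
    and "a - b \<noteq> 0 \<Longrightarrow> B (sgn (a - b)) (- sgn (a - b)) = lam"
proof -
  have Bb: "B u b = lam * (a \<bullet> u)" for u
    using linear_eq_of_attained_bound[of "\<lambda>u. B u b" lam a u] lin bnd a b ab by simp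
  have "linear (\<lambda>v. B a v)"
    using lin[of a] by (simp add: sym)
  then have Ba: "B a v = lam * (b \<bullet> v)" for v
    using linear_eq_of_attained_bound[of "\<lambda>v. B a v" lam b v] bnd a b ab by (simp add: sym)
  have add: "B (a + b) v = lam * ((a + b) \<bullet> v)" for v
    using linear_add[OF lin, of a b v] Ba[of v] Bb[of v] sym[of b v]
    by (simp add: inner_add_left algebra_simps)
  have diff: "B (a - b) v = - lam * ((a - b) \<bullet> v)" for v
    using linear_diff[OF lin, of a b v] Ba[of v] Bb[of v] sym[of b v]
    by (simp add: inner_diff_left algebra_simps)
  have scale: "B (c *\<^sub>R w) v = c * B w v" for c w v
    using linear_cmul[OF lin, of c w v] by simp
  show "a + b \<noteq> 0 \<Longrightarrow> B (sgn (a + b)) (sgn (a + b)) = lam"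
    by (simp add: scale add sgn_div_norm dot_square_norm power2_eq_square) (simp add: field_simps)
  show "a - b \<noteq> 0 \<Longrightarrow> B (sgn (a - b)) (- sgn (a - b)) = lam"
    by (simp add: scale diff sgn_div_norm dot_square_norm power2_eq_square) (simp add: field_simps)
qed

lemma sym_tensor_maximizer_pair_sgn:
  fixes A :: "('d::finite, 'n::finite) tensor"
  assumes A: "A \<in> sym_tensors" and x: "unit_factors x" and max: "A \<bullet> outer x = spectral_norm A"
    and ij: "i \<noteq> j"
  shows "x i + x j \<noteq> 0 \<Longrightarrow>
      A \<bullet> outer (x(i := sgn (x i + x j), j := sgn (x i + x j))) = spectral_norm A"
    and "x i - x j \<noteq> 0 \<Longrightarrow>
      A \<bullet> outer (x(i := sgn (x i - x j), j := - sgn (x i - x j))) = spectral_norm A"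
proof -
  define B where "B u v = A \<bullet> outer (x(i := u, j := v))" for u v
  have lin: "linear (\<lambda>u. B u v)" for v
    unfolding B_def fun_upd_twist[OF ij] by (rule linear_inner_outer_upd)
  have sym: "B u v = B v u" for u v
  proof -
    have "x(j := u, i := v) = x(i := u, j := v) \<circ> Transposition.transpose i j"
      using ij by (auto simp: fun_eq_iff Transposition.transpose_def)
    then show ?thesis
      unfolding B_def fun_upd_twist[OF ij, of x v u]
      by (simp add: sym_tensor_inner_outer_comp[OF A bij_transpose])
  qed
  have bnd: "B u v \<le> spectral_norm A" if "norm u = 1" "norm v = 1" for u v
    unfolding B_def using x that by (intro inner_outer_le_spectral_norm) simp
  have "B (x i) (x j) = spectral_norm A"
    unfolding B_def using max by (simp only: fun_upd_triv)
  note sgn = symmetric_bilinear_max_sgn[OF lin sym bnd x[rule_format] x[rule_format] this]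
  show "x i + x j \<noteq> 0 \<Longrightarrow>
      A \<bullet> outer (x(i := sgn (x i + x j), j := sgn (x i + x j))) = spectral_norm A"
    using sgn(1) unfolding B_def .
  show "x i - x j \<noteq> 0 \<Longrightarrow>
      A \<bullet> outer (x(i := sgn (x i - x j), j := - sgn (x i - x j))) = spectral_norm A"
    using sgn(2) unfolding B_def .
qed

definition dyad :: "real^'n::finite \<Rightarrow> real^'n^'n" where
  "dyad y = (\<chi> m m'. y $ m * y $ m')"

definition dyad_sum :: "('d::finite \<Rightarrow> real^'n::finite) \<Rightarrow> real^'n^'n" where
  "dyad_sum x = (\<Sum>k\<in>UNIV. dyad (x k))"

lemma dyad_uminus: "dyad (- y) = dyad y"
  by (simp add: dyad_def vec_eq_iff)

lemma dyad_sgn: "dyad (sgn y) = inverse (norm y ^ 2) *\<^sub>R dyad y"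
  by (simp add: dyad_def vec_eq_iff sgn_div_norm power2_eq_square)

lemma dyad_add_dyad: "dyad a + dyad b = (1/2) *\<^sub>R (dyad (a + b) + dyad (a - b))"
  by (simp add: dyad_def vec_eq_iff algebra_simps)

lemma dyad_mult_vec: "dyad y *v v = (y \<bullet> v) *\<^sub>R y"
  by (simp add: dyad_def matrix_vector_mult_def inner_vec_def vec_eq_iff sum_distrib_left
      sum_distrib_right algebra_simps)

lemma dyad_sum_upd2:
  assumes "i \<noteq> j"
  shows "dyad_sum (x(i := u, j := v)) = (\<Sum>k\<in>UNIV - {i, j}. dyad (x k)) + dyad u + dyad v"
proof -
  have "dyad_sum (x(i := u, j := v)) =
      (\<Sum>k\<in>UNIV - {i, j}. dyad ((x(i := u, j := v)) k)) + (\<Sum>k\<in>{i, j}. dyad ((x(i := u, j := v)) k))"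
    unfolding dyad_sum_def by (rule sum.subset_diff) auto
  also have "\<dots> = (\<Sum>k\<in>UNIV - {i, j}. dyad (x k)) + (dyad u + dyad v)"
    using assms by (auto intro!: sum.cong)
  finally show ?thesis
    by (simp only: add.assoc)
qed

lemma norm_convex_comb_power2_lt:
  fixes U V :: "'a::real_inner"
  assumes P: "0 < P" and R: "0 < R" and PR: "P + R = 1" and UV: "U \<noteq> V"
  shows "norm (P *\<^sub>R U + R *\<^sub>R V)^2 < max (norm U ^ 2) (norm V ^ 2)"
proof -
  have R_eq: "R = 1 - P"
    using PR by simp
  have "norm (P *\<^sub>R U + R *\<^sub>R V)^2 = P * norm U ^ 2 + R * norm V ^ 2 - P * R * norm (U - V) ^ 2"
    unfolding R_eq power2_norm_eq_inner
    by (simp add: inner_add_left inner_add_right inner_diff_left inner_diff_right inner_commute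
        algebra_simps)
  also have "\<dots> < P * norm U ^ 2 + R * norm V ^ 2"
    using P R UV by simp
  also have "\<dots> \<le> P * max (norm U ^ 2) (norm V ^ 2) + R * max (norm U ^ 2) (norm V ^ 2)"
    using P R by (intro add_mono mult_left_mono) auto
  finally show ?thesis
    using PR by (simp flip: distrib_right)
qed

lemma dyad_sgn_scaled: "w \<noteq> 0 \<Longrightarrow> (norm w ^ 2 / 4) *\<^sub>R (2 *\<^sub>R dyad (sgn w)) = (1/2) *\<^sub>R dyad w"
proof -
  assume "w \<noteq> 0"
  then have "norm w ^ 2 / 4 * (2 * inverse (norm w ^ 2)) = 1/2"
    by (simp add: field_simps)
  then show ?thesis
    by (simp only: dyad_sgn scaleR_scaleR)
qed

lemma dyad_add_dyad_sgn:
  fixes a b :: "real^'n::finite"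
  assumes "a + b \<noteq> 0" and "a - b \<noteq> 0"
  shows "dyad a + dyad b = (norm (a + b)^2 / 4) *\<^sub>R (2 *\<^sub>R dyad (sgn (a + b)))
    + (norm (a - b)^2 / 4) *\<^sub>R (2 *\<^sub>R dyad (sgn (a - b)))"
  by (simp only: dyad_sgn_scaled[OF assms(1)] dyad_sgn_scaled[OF assms(2)] dyad_add_dyad[of a b]
      scaleR_add_right)

lemma dyad_sgn_neq_of_orthogonal:
  fixes s d :: "real^'n::finite"
  assumes s: "s \<noteq> 0" and orth: "d \<bullet> s = 0"
  shows "dyad (sgn s) \<noteq> dyad (sgn d)"
proof
  assume eq: "dyad (sgn s) = dyad (sgn d)"
  have "dyad (sgn s) *v sgn s = sgn s"
    using s by (simp add: dyad_mult_vec dot_square_norm norm_sgn)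
  moreover have "dyad (sgn d) *v sgn s = 0"
    using orth by (simp add: dyad_mult_vec sgn_div_norm)
  ultimately show False
    using s eq by (simp add: sgn_zero_iff)
qed

text \<open>a a^T + b b^T is a proper convex combination of 2 s s^T and 2 d d^T, where s and d are
  the normalized sum and difference of the unit vectors a and b; strict convexity of the squared
  norm does the rest.\<close>

lemma dyad_sum_pair_sgn:
  fixes x :: "'d::finite \<Rightarrow> real^'n::finite"
  assumes x: "unit_factors x" and ij: "i \<noteq> j" and s: "x i + x j \<noteq> 0" and d: "x i - x j \<noteq> 0"
  shows "norm (dyad_sum x)^2 <
    max (norm (dyad_sum (x(i := sgn (x i + x j), j := sgn (x i + x j))))^2)
        (norm (dyad_sum (x(i := sgn (x i - x j), j := - sgn (x i - x j))))^2)"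
proof -
  define a b where "a = x i" and "b = x j"
  have a: "a \<bullet> a = 1" and b: "b \<bullet> b = 1"
    using x by (simp_all add: a_def b_def dot_square_norm)
  define P R where "P = norm (a + b)^2 / 4" and "R = norm (a - b)^2 / 4"
  have "norm (a + b)^2 + norm (a - b)^2 = 4"
    using a b by (simp add: dot_square_norm[symmetric] inner_add_left inner_add_right
        inner_diff_left inner_diff_right inner_commute)
  then have PR: "P + R = 1"
    by (simp add: P_def R_def)
  have P: "0 < P" and R: "0 < R"
    using s d by (simp_all add: P_def R_def a_def b_def)
  define Rest where "Rest = (\<Sum>k\<in>UNIV - {i, j}. dyad (x k))"
  define U where "U = Rest + 2 *\<^sub>R dyad (sgn (a + b))"
  define V where "V = Rest + 2 *\<^sub>R dyad (sgn (a - b))"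
  have U: "dyad_sum (x(i := sgn (a + b), j := sgn (a + b))) = U"
    and V: "dyad_sum (x(i := sgn (a - b), j := - sgn (a - b))) = V"
    by (simp_all only: U_def V_def Rest_def dyad_sum_upd2[OF ij] dyad_uminus scaleR_2 add.assoc)
  have "dyad a + dyad b = P *\<^sub>R (2 *\<^sub>R dyad (sgn (a + b))) + R *\<^sub>R (2 *\<^sub>R dyad (sgn (a - b)))"
    unfolding P_def R_def using s d by (intro dyad_add_dyad_sgn) (simp_all add: a_def b_def)
  moreover have "dyad_sum x = Rest + (dyad a + dyad b)"
    using dyad_sum_upd2[OF ij, of x a b] by (simp add: Rest_def a_def b_def add.assoc)
  ultimately have "dyad_sum x = (P + R) *\<^sub>R Rest + (P *\<^sub>R (2 *\<^sub>R dyad (sgn (a + b)))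
      + R *\<^sub>R (2 *\<^sub>R dyad (sgn (a - b))))"
    by (simp add: PR)
  also have "\<dots> = P *\<^sub>R U + R *\<^sub>R V"
    by (simp add: U_def V_def scaleR_add_right scaleR_add_left algebra_simps)
  finally have X: "dyad_sum x = P *\<^sub>R U + R *\<^sub>R V" .
  have "(a - b) \<bullet> (a + b) = 0"
    using a b by (simp add: inner_add_right inner_diff_left inner_diff_right inner_commute)
  then have "U \<noteq> V"
    using dyad_sgn_neq_of_orthogonal[of "a + b" "a - b"] s by (simp add: U_def V_def a_def b_def)
  then show ?thesis
    unfolding X U[unfolded a_def b_def] V[unfolded a_def b_def]
    by (rule norm_convex_comb_power2_lt[OF P R PR])
qed

text \<open>Among the maximizers of a symmetric tensor, one that maximizes the norm of the sum of the
  dyads x_k x_k^T has all factors equal up to sign, because averaging two factors that are not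
  would keep the maximum and increase that norm.\<close>

lemma sign_aligned_of_dyad_sum_max:
  fixes A :: "('d::finite, 'n::finite) tensor"
  assumes A: "A \<in> sym_tensors" and x: "unit_factors x" "A \<bullet> outer x = spectral_norm A"
    and x_max: "\<And>y. unit_factors y \<Longrightarrow> A \<bullet> outer y = spectral_norm A \<Longrightarrow>
      norm (dyad_sum y)^2 \<le> norm (dyad_sum x)^2"
  shows "x i = x j \<or> x i = - x j"
proof (rule ccontr)
  assume "\<not> (x i = x j \<or> x i = - x j)"
  then have ij: "i \<noteq> j" and s: "x i + x j \<noteq> 0" and d: "x i - x j \<noteq> 0"
    by (auto simp: add_eq_0_iff2)
  have u: "unit_factors (x(i := sgn (x i + x j), j := sgn (x i + x j)))"
    and v: "unit_factors (x(i := sgn (x i - x j), j := - sgn (x i - x j)))"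
    using x(1) s d by (auto simp: norm_sgn)
  have "norm (dyad_sum (x(i := sgn (x i + x j), j := sgn (x i + x j))))^2 \<le> norm (dyad_sum x)^2"
    using x_max[OF u sym_tensor_maximizer_pair_sgn(1)[OF A x ij s]] .
  moreover have
    "norm (dyad_sum (x(i := sgn (x i - x j), j := - sgn (x i - x j))))^2 \<le> norm (dyad_sum x)^2"
    using x_max[OF v sym_tensor_maximizer_pair_sgn(2)[OF A x ij d]] .
  ultimately show False
    using dyad_sum_pair_sgn[OF x(1) ij s d] unfolding less_max_iff_disj by linarith
qed

lemma exists_sign_aligned_maximizer:
  fixes A :: "('d::finite, 'n::finite) tensor"
  assumes A: "A \<in> sym_tensors"
  obtains x where "unit_factors x" "A \<bullet> outer x = spectral_norm A" "\<And>i j. x i = x j \<or> x i = - x j"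
proof -
  define M where "M = unit_factor_tuples \<inter> {X. A \<bullet> outer (($) X) = spectral_norm A}"
  have "compact M"
    unfolding M_def
    by (intro compact_Int_closed compact_unit_factor_tuples closed_Collect_eq continuous_intros
        continuous_on_outer_tuple)
  have mem_M: "vec_lambda x \<in> M \<longleftrightarrow> unit_factors x \<and> A \<bullet> outer x = spectral_norm A" for x
    by (simp add: M_def vec_lambda_mem_unit_factor_tuples vec_lambda_inverse)
  obtain x0 where "unit_factors x0" "A \<bullet> outer x0 = spectral_norm A"
    using spectral_norm_attained by blast
  then have "M \<noteq> {}"
    using mem_M by blast
  moreover have "continuous_on M (\<lambda>X. norm (dyad_sum (($) X))^2)"
    unfolding dyad_sum_def dyad_def by (intro continuous_intros)
  ultimately obtain X where "X \<in> M" and X_max: "\<And>Y. Y \<in> M \<Longrightarrow>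
      norm (dyad_sum (($) Y))^2 \<le> norm (dyad_sum (($) X))^2"
    using continuous_attains_sup[OF \<open>compact M\<close>] by blast
  define x where "x = ($) X"
  have x: "unit_factors x" "A \<bullet> outer x = spectral_norm A"
    using \<open>X \<in> M\<close> mem_M[of x] by (simp_all add: x_def)
  moreover have "norm (dyad_sum y)^2 \<le> norm (dyad_sum x)^2"
    if "unit_factors y" "A \<bullet> outer y = spectral_norm A" for y
    using X_max[of "vec_lambda y"] that mem_M by (simp add: x_def vec_lambda_inverse)
  ultimately show ?thesis
    using that sign_aligned_of_dyad_sum_max[OF A] by blast
qed

definition sym_unit_rank_one :: "('d::finite, 'n::finite) tensor set" where
  "sym_unit_rank_one = {s *\<^sub>R outer (\<lambda>_. y) | s y. (s = 1 \<or> s = -1) \<and> norm y = 1}"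

lemma sym_unit_rank_one_outer:
  assumes "E \<in> (sym_unit_rank_one :: ('d::finite, 'n::finite) tensor set)"
  obtains x where "unit_factors x" "E = outer x"
proof -
  obtain s and y :: "real^'n" where s: "s = 1 \<or> s = -1" and y: "norm y = 1"
    and E: "E = s *\<^sub>R outer (\<lambda>_::'d. y)"
    using assms by (auto simp: sym_unit_rank_one_def)
  let ?x = "(\<lambda>_::'d. y)(undefined := s *\<^sub>R y)"
  have "unit_factors ?x"
    using s y by auto
  moreover have "E = outer ?x"
    using outer_upd_scale_self[of "\<lambda>_::'d. y" undefined s] E by simp
  ultimately show ?thesis
    by (rule that)
qed

lemma sym_unit_rank_one_subset: "sym_unit_rank_one \<subseteq> sym_tensors"
  unfolding sym_unit_rank_one_def
  using subspace_sym_tensors outer_const_mem_sym_tensors by (auto intro: subspace_scale)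

lemma closed_sym_unit_rank_one: "closed (sym_unit_rank_one :: ('d::finite, 'n::finite) tensor set)"
proof -
  have "sym_unit_rank_one = (\<lambda>(s, y). s *\<^sub>R outer (\<lambda>_::'d. y :: real^'n)) ` ({1, -1} \<times> sphere 0 1)"
    by (auto simp: sym_unit_rank_one_def image_iff) (metis scaleR_one, metis scaleR_minus1_left)
  moreover have "compact ((\<lambda>(s, y). s *\<^sub>R outer (\<lambda>_::'d. y :: real^'n)) ` ({1, -1} \<times> sphere 0 1))"
    by (intro compact_continuous_image compact_Times compact_sphere finite_imp_compact)
      (auto simp: outer_def case_prod_beta intro!: continuous_intros)
  ultimately show ?thesis
    by (simp add: compact_imp_closed)
qed

lemma exists_sym_maximizer:
  fixes A :: "('d::finite, 'n::finite) tensor"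
  assumes "A \<in> sym_tensors"
  shows "\<exists>E\<in>sym_unit_rank_one. A \<bullet> E = spectral_norm A"
proof -
  obtain x where x: "unit_factors x" "A \<bullet> outer x = spectral_norm A"
    and pm: "\<And>i j. x i = x j \<or> x i = - x j"
    using exists_sign_aligned_maximizer[OF assms] by blast
  define y where "y = x undefined"
  define s where "s k = (if x k = y then 1 else - 1 :: real)" for k
  have "x = (\<lambda>k. s k *\<^sub>R y)"
    using pm[of _ undefined] by (auto simp: fun_eq_iff s_def y_def)
  then have "outer x = (\<Prod>k\<in>UNIV. s k) *\<^sub>R outer (\<lambda>_. y)"
    by (simp add: outer_scale)
  moreover have "\<bar>s k\<bar> = 1" for k
    by (simp add: s_def)
  then have "\<bar>\<Prod>k\<in>UNIV. s k\<bar> = 1"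
    by (simp add: abs_prod)
  then have "(\<Prod>k\<in>UNIV. s k) = 1 \<or> (\<Prod>k\<in>UNIV. s k) = -1"
    by linarith
  ultimately have "outer x \<in> sym_unit_rank_one"
    using x(1) by (auto simp: sym_unit_rank_one_def y_def)
  then show ?thesis
    using x(2) by blast
qed

section \<open>Gradients of the spectral norm\<close>

lemma has_derivative_of_quadratic_remainder:
  fixes f :: "'a::real_normed_vector \<Rightarrow> real"
  assumes L: "bounded_linear L" and rem: "\<And>h. \<bar>f (q + h) - f q - L h\<bar> \<le> C * norm h ^ 2"
  shows "(f has_derivative L) (at q)"
  unfolding has_derivative_at
proof (intro conjI L)
  have bound: "norm (norm (f (q + h) - f q - L h) / norm h) \<le> C * norm h" for h
  proof (cases "h = 0")
    case False
    have "\<bar>f (q + h) - f q - L h\<bar> / norm h \<le> C * norm h ^ 2 / norm h"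
      by (rule divide_right_mono[OF rem norm_ge_zero])
    then show ?thesis
      using False by (simp add: power2_eq_square)
  qed simp
  have "(\<lambda>h. C * norm h) \<midarrow>0\<rightarrow> 0"
    by (rule tendsto_mult_right_zero[OF tendsto_norm_zero[OF tendsto_ident_at]])
  then show "(\<lambda>h. norm (f (q + h) - f q - L h) / norm h) \<midarrow>0\<rightarrow> 0"
    by (rule Lim_null_comparison[OF always_eventually, rotated]) (rule allI, rule bound)
qed

lemma spectral_norm_add_maximizer:
  fixes p :: "('d::finite, 'n::finite) tensor"
  assumes x: "unit_factors x" and max: "p \<bullet> outer x = spectral_norm p" and t: "0 \<le> t"
  shows "spectral_norm (p + t *\<^sub>R outer x) = spectral_norm p + t"
proof (rule antisym)
  show "spectral_norm (p + t *\<^sub>R outer x) \<le> spectral_norm p + t"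
  proof (rule spectral_norm_le)
    fix z :: "'d \<Rightarrow> real^'n"
    assume z: "unit_factors z"
    have "outer x \<bullet> outer z \<le> 1"
      using norm_cauchy_schwarz[of "outer x" "outer z"] x z by (simp add: norm_outer_unit)
    then have "t * (outer x \<bullet> outer z) \<le> t"
      by (rule mult_left_le[OF _ t])
    then show "(p + t *\<^sub>R outer x) \<bullet> outer z \<le> spectral_norm p + t"
      using inner_outer_le_spectral_norm[OF z, of p] by (simp add: inner_add_left)
  qed
  show "spectral_norm p + t \<le> spectral_norm (p + t *\<^sub>R outer x)"
    using inner_outer_le_spectral_norm[OF x, of "p + t *\<^sub>R outer x"] max x
    by (simp add: inner_add_left dot_square_norm norm_outer_unit)
qed

text \<open>Past a maximizer E of p, the spectral norm is pinned between the linear function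
  given by E and a quadratic: a unit rank-one Z at distance \<delta> from E only gains
  |h| \<delta> - t \<delta>^2/2 \<le> |h|^2/(2t) over E.\<close>

lemma spectral_norm_add_maximizer_le:
  fixes p :: "('d::finite, 'n::finite) tensor"
  assumes x: "unit_factors x" and max: "p \<bullet> outer x = spectral_norm p" and t: "0 < t"
  defines "q \<equiv> p + t *\<^sub>R outer x"
  shows "spectral_norm (q + h) \<le> spectral_norm q + outer x \<bullet> h + norm h ^ 2 / (2 * t)"
proof (rule spectral_norm_le)
  fix z :: "'d \<Rightarrow> real^'n"
  assume z: "unit_factors z"
  define E Z where "E = outer x" and "Z = outer z"
  define \<delta> where "\<delta> = norm (Z - E)"
  have EZ: "E \<bullet> Z = 1 - \<delta>^2 / 2"
    unfolding \<delta>_def norm_diff_power2 using x z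
    by (simp add: E_def Z_def norm_outer_unit inner_commute field_simps)
  have hZ: "h \<bullet> Z \<le> E \<bullet> h + norm h * \<delta>"
    using norm_cauchy_schwarz[of h "Z - E"] by (simp add: \<delta>_def inner_diff_right inner_commute)
  have am_gm: "norm h * \<delta> - t * \<delta>^2 / 2 \<le> norm h ^ 2 / (2 * t)"
  proof -
    have "0 \<le> (norm h - t * \<delta>)^2"
      by simp
    then have "2 * t * (norm h * \<delta> - t * \<delta>^2 / 2) \<le> norm h ^ 2"
      by (simp add: power2_diff power_mult_distrib algebra_simps power2_eq_square)
    then show ?thesis
      using t by (simp add: field_simps)
  qed
  have pZ: "p \<bullet> Z \<le> spectral_norm p"
    unfolding Z_def by (rule inner_outer_le_spectral_norm[OF z])
  have q: "spectral_norm q = spectral_norm p + t"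
    unfolding q_def by (rule spectral_norm_add_maximizer[OF x max less_imp_le[OF t]])
  have "(q + h) \<bullet> Z = p \<bullet> Z + t * (1 - \<delta>^2 / 2) + h \<bullet> Z"
    by (simp add: q_def E_def[symmetric] inner_add_left EZ)
  also have "\<dots> \<le> spectral_norm q + E \<bullet> h + norm h ^ 2 / (2 * t)"
    using pZ hZ am_gm q by (simp add: right_diff_distrib)
  finally show "(q + h) \<bullet> outer z \<le> spectral_norm q + outer x \<bullet> h + norm h ^ 2 / (2 * t)"
    by (simp add: E_def Z_def)
qed

lemma has_derivative_spectral_norm_add_maximizer:
  fixes p :: "('d::finite, 'n::finite) tensor"
  assumes x: "unit_factors x" and max: "p \<bullet> outer x = spectral_norm p" and t: "0 < t"
  shows "(spectral_norm has_derivative (\<lambda>h. outer x \<bullet> h)) (at (p + t *\<^sub>R outer x))"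
proof (rule has_derivative_of_quadratic_remainder[where C = "1 / (2 * t)"])
  show "bounded_linear ((\<bullet>) (outer x))"
    by (rule bounded_linear_inner_right)
  fix h
  let ?q = "p + t *\<^sub>R outer x"
  have "outer x \<bullet> outer x = 1"
    using x by (simp add: dot_square_norm norm_outer_unit)
  then have "spectral_norm ?q + outer x \<bullet> h = (?q + h) \<bullet> outer x"
    using max spectral_norm_add_maximizer[OF x max less_imp_le[OF t]]
    by (simp add: inner_add_left inner_commute[of h])
  also have "\<dots> \<le> spectral_norm (?q + h)"
    by (rule inner_outer_le_spectral_norm[OF x])
  finally show "\<bar>spectral_norm (?q + h) - spectral_norm ?q - outer x \<bullet> h\<bar> \<le> 1 / (2 * t) * norm h ^ 2"
    using spectral_norm_add_maximizer_le[OF x max t, of h] by simp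
qed

lemma convex_clarke_grad: "convex (clarke_grad S f p)"
  unfolding clarke_grad_def by (rule convex_convex_hull)

lemma maximizer_mem_clarke_grad:
  fixes p :: "('d::finite, 'n::finite) tensor"
  assumes S: "subspace S" and "p \<in> S" and "outer x \<in> S"
    and x: "unit_factors x" and max: "p \<bullet> outer x = spectral_norm p"
  shows "outer x \<in> clarke_grad S spectral_norm p"
  unfolding clarke_grad_def
proof (rule hull_inc, rule CollectI, intro exI conjI allI)
  let ?ps = "\<lambda>k. p + inverse (real (Suc k)) *\<^sub>R outer x"
  fix k
  show "?ps k \<in> S"
    using assms by (simp add: subspace_add subspace_scale)
  show "(spectral_norm has_derivative (\<bullet>) (outer x)) (at (?ps k) within S)"
    by (rule has_derivative_at_withinI, rule has_derivative_spectral_norm_add_maximizer[OF x max]) simp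
next
  show "(\<lambda>k. p + inverse (real (Suc k)) *\<^sub>R outer x) \<longlonglongrightarrow> p"
    using tendsto_add[OF tendsto_const tendsto_scaleR[OF LIMSEQ_inverse_real_of_nat tendsto_const],
        of p "outer x"]
    by simp
qed (use assms in simp_all)

lemma has_derivative_eq_of_line_minorant:
  fixes f :: "'a::real_normed_vector \<Rightarrow> real"
  assumes f': "(f has_derivative D) (at q within S)" and line: "\<And>t. q + t *\<^sub>R h \<in> S"
    and minorant: "\<And>t. f q + t * c \<le> f (q + t *\<^sub>R h)"
  shows "D h = c"
proof -
  define l where "l t = q + t *\<^sub>R h" for t :: real
  have l': "(l has_derivative (\<lambda>t. t *\<^sub>R h)) (at 0)"
    unfolding l_def by (auto intro!: derivative_eq_intros)
  have "range l \<subseteq> S"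
    using line by (auto simp: l_def)
  then have "(f has_derivative D) (at (l 0) within range l)"
    using has_derivative_subset[OF f'] by (simp add: l_def)
  then have "((\<lambda>t. f (l t)) has_derivative (\<lambda>t. D (t *\<^sub>R h))) (at 0)"
    by (rule has_derivative_in_compose[OF l'])
  then have "((\<lambda>t. f (l t) - t * c) has_derivative (\<lambda>t. D (t *\<^sub>R h) - t * c)) (at 0)"
    by (auto intro!: derivative_eq_intros)
  moreover have "(\<lambda>t. D (t *\<^sub>R h) - t * c) = (*) (D h - c)"
    using linear_cmul[OF has_derivative_linear[OF f'], of _ h] by (auto simp: fun_eq_iff algebra_simps)
  ultimately have deriv: "((\<lambda>t. f (l t) - t * c) has_real_derivative (D h - c)) (at 0)"
    by (simp add: has_field_derivative_def)
  have min: "\<forall>t. \<bar>0 - t\<bar> < 1 \<longrightarrow> f (l 0) - 0 * c \<le> f (l t) - t * c"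
    using minorant by (simp add: l_def algebra_simps)
  have "D h - c = 0"
    by (rule DERIV_local_min[OF deriv _ min]) simp
  then show ?thesis
    by simp
qed

lemma has_derivative_eq_of_linear_minorant:
  fixes f :: "'a::euclidean_space \<Rightarrow> real"
  assumes S: "subspace S" and "q \<in> S" "v \<in> S" "E \<in> S"
    and f': "(f has_derivative (\<lambda>h. v \<bullet> h)) (at q within S)"
    and minorant: "\<And>r. r \<in> S \<Longrightarrow> r \<bullet> E \<le> f r" and touch: "q \<bullet> E = f q"
  shows "v = E"
proof -
  have "v \<bullet> h = E \<bullet> h" if "h \<in> S" for h
  proof (rule has_derivative_eq_of_line_minorant[OF f'])
    show "q + t *\<^sub>R h \<in> S" for t
      using S \<open>q \<in> S\<close> that by (simp add: subspace_add subspace_scale)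
    then show "f q + t * (E \<bullet> h) \<le> f (q + t *\<^sub>R h)" for t
      using minorant[of "q + t *\<^sub>R h"] touch by (simp add: inner_add_left inner_commute[of h])
  qed
  from this[of "v - E"] have "(v - E) \<bullet> (v - E) = 0"
    using S assms(3,4) by (simp add: subspace_diff inner_diff_left)
  then show ?thesis
    by simp
qed

lemma sym_gradient_mem_sym_unit_rank_one:
  fixes q v :: "('d::finite, 'n::finite) tensor"
  assumes "q \<in> sym_tensors" and "v \<in> sym_tensors"
    and "(spectral_norm has_derivative (\<lambda>h. v \<bullet> h)) (at q within sym_tensors)"
  shows "v \<in> sym_unit_rank_one \<and> q \<bullet> v = spectral_norm q"
proof -
  obtain E where E: "E \<in> sym_unit_rank_one" and qE: "q \<bullet> E = spectral_norm q"
    using exists_sym_maximizer[OF assms(1)] by blast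
  obtain x where "unit_factors x" "E = outer x"
    using sym_unit_rank_one_outer[OF E] by blast
  then have "r \<bullet> E \<le> spectral_norm r" for r
    by (simp add: inner_outer_le_spectral_norm)
  moreover have "E \<in> sym_tensors"
    using E sym_unit_rank_one_subset by blast
  ultimately have "v = E"
    using has_derivative_eq_of_linear_minorant[OF subspace_sym_tensors assms(1,2) _ assms(3) _ qE]
    by blast
  then show ?thesis
    using E qE by simp
qed

lemma clarke_grad_sym_subset:
  fixes p :: "('d::finite, 'n::finite) tensor"
  shows "clarke_grad sym_tensors spectral_norm p
    \<subseteq> convex hull {v \<in> sym_unit_rank_one. p \<bullet> v = spectral_norm p}"
  unfolding clarke_grad_def
proof (rule hull_mono, rule subsetI, elim CollectE exE conjE)
  fix v and ps vs :: "nat \<Rightarrow> ('d, 'n) tensor"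
  assume H: "\<forall>k. ps k \<in> sym_tensors \<and> vs k \<in> sym_tensors \<and>
      (spectral_norm has_derivative (\<lambda>h. vs k \<bullet> h)) (at (ps k) within sym_tensors)"
    and ps: "ps \<longlonglongrightarrow> p" and vs: "vs \<longlonglongrightarrow> v"
  have G: "vs k \<in> sym_unit_rank_one \<and> ps k \<bullet> vs k = spectral_norm (ps k)" for k
    using H sym_gradient_mem_sym_unit_rank_one by blast
  have "v \<in> sym_unit_rank_one"
    by (rule closed_sequentially[OF closed_sym_unit_rank_one _ vs]) (use G in blast)
  moreover have "(\<lambda>k. ps k \<bullet> vs k) \<longlonglongrightarrow> p \<bullet> v"
    by (rule tendsto_inner[OF ps vs])
  moreover have "(\<lambda>k. ps k \<bullet> vs k) \<longlonglongrightarrow> spectral_norm p"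
    using tendsto_spectral_norm[OF ps] G by simp
  ultimately show "v \<in> {v \<in> sym_unit_rank_one. p \<bullet> v = spectral_norm p}"
    using LIMSEQ_unique by blast
qed

section \<open>Critical points\<close>

lemma mem_convex_hull_iff_indexed_sum:
  fixes v :: "'a::real_vector"
  shows "v \<in> convex hull K \<longleftrightarrow>
    (\<exists>(r::nat) (Y::nat \<Rightarrow> 'a) (\<alpha>::nat \<Rightarrow> real). (\<forall>l<r. Y l \<in> K) \<and> (\<forall>l<r. \<alpha> l > 0) \<and>
       (\<Sum>l<r. \<alpha> l) = 1 \<and> v = (\<Sum>l<r. \<alpha> l *\<^sub>R Y l))" (is "_ \<longleftrightarrow> ?indexed")
proof
  assume "v \<in> convex hull K"
  then obtain T u where T: "finite T" "T \<subseteq> K" and u: "\<forall>y\<in>T. 0 \<le> u y" "sum u T = 1"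
    and v: "(\<Sum>y\<in>T. u y *\<^sub>R y) = v"
    unfolding convex_hull_explicit by blast
  define T' where "T' = {y \<in> T. u y \<noteq> 0}"
  obtain f where f: "bij_betw f {..<card T'} T'"
    using ex_bij_betw_nat_finite[of T'] T(1) by (auto simp: T'_def atLeast0LessThan)
  have sum_T': "sum g T' = sum g T" if "\<And>y. y \<in> T \<Longrightarrow> u y = 0 \<Longrightarrow> g y = 0"
    for g :: "'a \<Rightarrow> 'b::comm_monoid_add"
    using that T(1) by (intro sum.mono_neutral_left) (auto simp: T'_def)
  show ?indexed
  proof (intro exI conjI allI impI)
    fix l
    assume "l < card T'"
    then have "f l \<in> T'"
      using f by (auto simp: bij_betw_def)
    then show "f l \<in> K" and "0 < (u \<circ> f) l"
      using T(2) u(1) by (auto simp: T'_def order.strict_iff_order)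
  next
    show "(\<Sum>l<card T'. (u \<circ> f) l) = 1"
      using sum.reindex_bij_betw[OF f, of u] sum_T'[of u] u(2) by simp
    show "v = (\<Sum>l<card T'. (u \<circ> f) l *\<^sub>R f l)"
      using sum.reindex_bij_betw[OF f, of "\<lambda>y. u y *\<^sub>R y"] sum_T'[of "\<lambda>y. u y *\<^sub>R y"] v by simp
  qed
next
  assume ?indexed
  then obtain r :: nat and Y \<alpha> where "\<forall>l<r. Y l \<in> K" "\<forall>l<r. \<alpha> l > 0" "(\<Sum>l<r. \<alpha> l) = 1"
    and v: "v = (\<Sum>l<r. \<alpha> l *\<^sub>R Y l)"
    by blast
  then show "v \<in> convex hull K"
    unfolding v by (intro convex_sum convex_convex_hull) (auto intro: hull_inc less_imp_le)
qed

lemma sym_rank_one_form_mem_sym_tensors: "sym_rank_one_form Y \<Longrightarrow> Y \<in> sym_tensors"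
  unfolding sym_rank_one_form_def
  using subspace_sym_tensors outer_const_mem_sym_tensors by (auto intro: subspace_scale)

lemma best_rank_one_approx_sym_unit_rank_one:
  fixes A :: "('d::finite, 'n::finite) tensor"
  assumes A: "A \<noteq> 0" and v: "v \<in> sym_unit_rank_one" and max: "A \<bullet> v = spectral_norm A"
  shows "best_rank_one_approx A (spectral_norm A *\<^sub>R v)" and "sym_rank_one_form (spectral_norm A *\<^sub>R v)"
proof -
  obtain x where "unit_factors x" "v = outer x"
    using sym_unit_rank_one_outer[OF v] by blast
  then show "best_rank_one_approx A (spectral_norm A *\<^sub>R v)"
    using best_rank_one_approx_maximizer[OF A] max by simp
  obtain s and y :: "real^'n" where "v = s *\<^sub>R outer (\<lambda>_::'d. y)"
    using v by (auto simp: sym_unit_rank_one_def)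
  then show "sym_rank_one_form (spectral_norm A *\<^sub>R v)"
    unfolding sym_rank_one_form_def by (auto intro!: exI[of _ "spectral_norm A * s"])
qed

lemma normalized_inner_eq_spectral_norm_iff:
  fixes A :: "('d::finite, 'n::finite) tensor"
  assumes "A \<noteq> 0"
  shows "(A /\<^sub>R norm A) \<bullet> v = spectral_norm (A /\<^sub>R norm A) \<longleftrightarrow> A \<bullet> v = spectral_norm A"
  using assms by (simp add: spectral_norm_scaleR)

lemma clarke_grad_sym_imp_mem_convex_hull:
  fixes A :: "('d::finite, 'n::finite) tensor"
  assumes A: "A \<noteq> 0" and crit: "c *\<^sub>R A \<in> clarke_grad sym_tensors spectral_norm (A /\<^sub>R norm A)"
  shows "(spectral_norm A / norm A)\<^sup>2 *\<^sub>R A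
    \<in> convex hull {Y. best_rank_one_approx A Y \<and> sym_rank_one_form Y}"
proof -
  define K where "K = {v \<in> sym_unit_rank_one. A \<bullet> v = spectral_norm A}"
  have cK: "c *\<^sub>R A \<in> convex hull K"
    using crit clarke_grad_sym_subset[of "A /\<^sub>R norm A"]
    unfolding K_def normalized_inner_eq_spectral_norm_iff[OF A] by blast
  have "convex hull K \<subseteq> {w. A \<bullet> w = spectral_norm A}"
    by (rule hull_minimal) (auto simp: K_def convex_hyperplane)
  then have "c * norm A ^ 2 = spectral_norm A"
    using cK by (auto simp: dot_square_norm)
  then have "c = spectral_norm A / norm A ^ 2"
    using A by (simp add: field_simps)
  then have "(spectral_norm A / norm A)\<^sup>2 *\<^sub>R A = spectral_norm A *\<^sub>R (c *\<^sub>R A)"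
    by (simp add: power_divide power2_eq_square)
  also have "\<dots> \<in> convex hull ((*\<^sub>R) (spectral_norm A) ` K)"
    unfolding convex_hull_scaling using cK by (rule imageI)
  also have "\<dots> \<subseteq> convex hull {Y. best_rank_one_approx A Y \<and> sym_rank_one_form Y}"
    by (rule hull_mono) (auto simp: K_def intro: best_rank_one_approx_sym_unit_rank_one[OF A])
  finally show ?thesis .
qed

lemma mem_convex_hull_imp_clarke_grad:
  fixes A :: "('d::finite, 'n::finite) tensor"
  assumes S: "subspace S" and "A \<in> S" and A: "A \<noteq> 0"
    and hull: "(spectral_norm A / norm A)\<^sup>2 *\<^sub>R A \<in> convex hull {Y. best_rank_one_approx A Y \<and> Y \<in> S}"
  shows "\<exists>c. c *\<^sub>R A \<in> clarke_grad S spectral_norm (A /\<^sub>R norm A)"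
proof -
  let ?s = "spectral_norm A" and ?p = "A /\<^sub>R norm A"
  have s: "0 < ?s"
    by (rule spectral_norm_pos[OF A])
  have "(*\<^sub>R) (inverse ?s) ` {Y. best_rank_one_approx A Y \<and> Y \<in> S} \<subseteq> clarke_grad S spectral_norm ?p"
  proof clarify
    fix Y
    assume "best_rank_one_approx A Y" "Y \<in> S"
    then obtain x where x: "unit_factors x" "Y = ?s *\<^sub>R outer x" "A \<bullet> outer x = ?s"
      using best_rank_one_approx_imp_maximizer[OF A] by blast
    then have "inverse ?s *\<^sub>R Y = outer x"
      using s by simp
    moreover have "outer x \<in> S"
      using S \<open>Y \<in> S\<close> calculation by (metis subspace_scale)
    moreover have "?p \<in> S"
      using S \<open>A \<in> S\<close> by (simp add: subspace_scale)
    moreover have "?p \<bullet> outer x = spectral_norm ?p"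
      unfolding normalized_inner_eq_spectral_norm_iff[OF A] by (rule x(3))
    ultimately show "inverse ?s *\<^sub>R Y \<in> clarke_grad S spectral_norm ?p"
      using maximizer_mem_clarke_grad[OF S _ _ x(1)] by simp
  qed
  then have "convex hull ((*\<^sub>R) (inverse ?s) ` {Y. best_rank_one_approx A Y \<and> Y \<in> S})
      \<subseteq> clarke_grad S spectral_norm ?p"
    by (rule hull_minimal) (rule convex_clarke_grad)
  moreover have "inverse ?s *\<^sub>R ((?s / norm A)\<^sup>2 *\<^sub>R A)
      \<in> convex hull ((*\<^sub>R) (inverse ?s) ` {Y. best_rank_one_approx A Y \<and> Y \<in> S})"
    unfolding convex_hull_scaling using hull by (rule imageI)
  ultimately show ?thesis
    by (metis (no_types, lifting) scaleR_scaleR subsetD)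
qed

theorem theorem1p9:
  fixes A :: "('d::finite, 'n::finite) tensor"
  assumes "A \<in> sym_tensors" and "A \<noteq> 0"
  shows "(critical_in_sym A \<longleftrightarrow>
            (\<exists>(r::nat) (Y::nat \<Rightarrow> ('d, 'n) tensor) (\<alpha>::nat \<Rightarrow> real).
               (\<forall>l<r. best_rank_one_approx A (Y l) \<and> sym_rank_one_form (Y l)) \<and>
               (\<forall>l<r. \<alpha> l > 0) \<and> (\<Sum>l<r. \<alpha> l) = 1 \<and>
               (spectral_norm A / norm A)\<^sup>2 *\<^sub>R A = (\<Sum>l<r. \<alpha> l *\<^sub>R Y l)))
         \<and> (critical_in_sym A \<longrightarrow> critical_in_full A)"
proof -
  let ?K = "{Y. best_rank_one_approx A Y \<and> sym_rank_one_form Y}"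
  let ?B = "(spectral_norm A / norm A)\<^sup>2 *\<^sub>R A"
  have K_subset: "?K \<subseteq> {Y. best_rank_one_approx A Y \<and> Y \<in> S}" if "sym_tensors \<subseteq> S" for S
    using that sym_rank_one_form_mem_sym_tensors by blast
  have sym_iff: "critical_in_sym A \<longleftrightarrow> ?B \<in> convex hull ?K"
    using clarke_grad_sym_imp_mem_convex_hull[OF assms(2)]
      mem_convex_hull_imp_clarke_grad[OF subspace_sym_tensors assms]
      hull_mono[OF K_subset[OF order.refl]] assms
    unfolding critical_in_sym_def by blast
  have "critical_in_sym A \<Longrightarrow> critical_in_full A"
    using mem_convex_hull_imp_clarke_grad[OF subspace_UNIV _ assms(2)]
      hull_mono[OF K_subset[OF subset_UNIV]] assms(2)
    unfolding sym_iff critical_in_full_def by blast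
  then show ?thesis
    unfolding sym_iff mem_convex_hull_iff_indexed_sum by auto
qed

end
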